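(* Let $n\ge 2$. There is a bijection between $\mathcal S_n$ and the set of vertex-labeled trees with vertex set $[n]=\{1,\dots,n\}$.
   Context: $\widetilde S_n$ is the affine symmetric group: bijections $w:\mathbb Z\to\mathbb Z$ with $w(i+n)=w(i)+n$ and $\sum_{i=1}^n w(i)=\binom{n+1}2$, under composition. Its simple reflections are $s_i=(\!(i,i+1)\!)$ for $i\in\{0,\dots,n-1\}$, where $(\!(i,j)\!)$ swaps $i+kn$ and $j+kn$ for every $k\in\mathbb Z$. $\bm\lambda_n$ is the word $[s_0,s_1,\dots,s_{n-1}]$ repeated $n-1$ times (length $n(n-1)$), with $j$-th letter $\sigma_j=s_{(j-1)\bmod n}$ (index in $\{0,\dots,n-1\}$). A subword is $\mathsf u=[u_1,\dots,u_{n(n-1)}]$ with each $u_j\in\{\sigma_j,e\}$ ($e$ the identity); $j$ is a skip if $u_j=e$. $\mathcal S_n$ (the maximal distinguished subwords of $\bm\lambda_n$) is the set of subwords with exactly $2n-2$ skips and $u_1u_2\cdots u_{n(n-1)}=e$. *)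

theory Defs
  imports Main
begin

(* Elements of the affine symmetric group are represented as functions int => int. *)

(* the affine transposition ((i,j)): swaps i+kn and j+kn for every integer k
   (used with i, j distinct modulo n) *)
definition aff_transp :: "nat \<Rightarrow> int \<Rightarrow> int \<Rightarrow> int \<Rightarrow> int" where
  "aff_transp n i j x =
     (if x mod int n = i mod int n then x + (j - i)
      else if x mod int n = j mod int n then x - (j - i)
      else x)"

(* simple reflection s_i = ((i, i+1)), i in {0..n-1} *)
definition simple_refl :: "nat \<Rightarrow> nat \<Rightarrow> int \<Rightarrow> int" where
  "simple_refl n i = aff_transp n (int i) (int i + 1)"

(* the word lambda_n = [s_0,...,s_{n-1}] repeated n-1 times, as a list;
   list position p (0-based) holds the letter sigma_{p+1} = s_{p mod n} *)
definition lambda_word :: "nat \<Rightarrow> (int \<Rightarrow> int) list" where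
  "lambda_word n = map (\<lambda>p. simple_refl n (p mod n)) [0..<n * (n - 1)]"

(* subwords of lambda_n: each letter u_j is sigma_j or the identity e *)
definition subwords :: "nat \<Rightarrow> (int \<Rightarrow> int) list set" where
  "subwords n = {u. length u = length (lambda_word n) \<and>
                    (\<forall>p < length u. u ! p = lambda_word n ! p \<or> u ! p = id)}"

(* skip positions (1-based, as in the paper) *)
definition skips :: "nat \<Rightarrow> (int \<Rightarrow> int) list \<Rightarrow> nat set" where
  "skips n u = {j. 1 \<le> j \<and> j \<le> length u \<and> u ! (j - 1) = id}"

(* product u_1 u_2 ... u_N in the group (composition of functions) *)
definition word_prod :: "(int \<Rightarrow> int) list \<Rightarrow> int \<Rightarrow> int" where
  "word_prod u = foldr (\<circ>) u id"

(* S_n: maximal distinguished subwords *)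
definition max_dist_subwords :: "nat \<Rightarrow> (int \<Rightarrow> int) list set" where
  "max_dist_subwords n = {u \<in> subwords n. card (skips n u) = 2 * n - 2 \<and> word_prod u = id}"

(* simple graphs on vertex set {1..n}: sets of 2-element subsets *)
definition graph_edges_on :: "nat \<Rightarrow> nat set set" where
  "graph_edges_on n = {{a, b} | a b. a \<in> {1..n} \<and> b \<in> {1..n} \<and> a \<noteq> b}"

definition adj_rel :: "nat set set \<Rightarrow> (nat \<times> nat) set" where
  "adj_rel E = {(a, b). {a, b} \<in> E \<and> a \<noteq> b}"

definition graph_connected :: "nat \<Rightarrow> nat set set \<Rightarrow> bool" where
  "graph_connected n E = (\<forall>a \<in> {1..n}. \<forall>b \<in> {1..n}. (a, b) \<in> (adj_rel E)\<^sup>*)"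

(* a cycle: at least 3 distinct vertices v_0,...,v_k with consecutive (cyclically) adjacent *)
definition has_cycle :: "nat set set \<Rightarrow> bool" where
  "has_cycle E = (\<exists>vs. 3 \<le> length vs \<and> distinct vs \<and>
                      (\<forall>i < length vs. {vs ! i, vs ! ((i + 1) mod length vs)} \<in> E))"

(* vertex-labeled trees with vertex set [n], identified with their edge sets *)
definition labeled_trees :: "nat \<Rightarrow> nat set set set" where
  "labeled_trees n = {E. E \<subseteq> graph_edges_on n \<and> graph_connected n E \<and> \<not> has_cycle E}"

end

theory Submission
  imports Defs "HOL-Combinatorics.Orbits"
begin

text \<open>
  Follow the label at position \<open>p\<close> just before letter \<open>p\<close> (counted from 0) is applied: call it
  the hand. The other \<open>n - 1\<close> residue classes sit in slots arranged on a circle, and each letter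
  moves the hand past one slot; a skip exchanges the label in hand with the label in that slot.
  Given a tree on \<open>{1..n}\<close>, skip exactly when hand and slot label are adjacent: the hand then
  performs a depth-first traversal from \<open>n\<close>, each vertex being in hand for exactly one round of the
  slots. Conversely, a word with product \<open>e\<close> has every label in hand for exactly \<open>n - 1\<close> steps.
  Hence each slot is used by some skip, indeed at least twice, so exactly twice when there are
  \<open>2 n - 2\<close> skips, and both skips exchange the same pair \<open>{s, y}\<close>. These
  pairs form a tree, and as every hand label meets every slot exactly once, no pair of tree
  neighbours is ever crossed. So the tree determines the skips.
\<close>

section \<open>Sweeping a hand along the slots\<close>

locale sweep =
  fixes n :: nat
  assumes n2: "2 \<le> n"
begin

text \<open>The reflections recur with period \<open>n\<close>, but the hand advances with them, so
  it faces the same slot again after \<open>n - 1\<close> letters.\<close>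

definition slot :: "nat \<Rightarrow> nat" where
  "slot p = p mod (n - 1) + 1"

text \<open>Index \<open>n\<close> holds the hand, the indices \<open>1..n-1\<close> are the slots; the label \<open>n\<close> stands for
  the residue class of 0.\<close>
primrec conf :: "nat set \<Rightarrow> nat \<Rightarrow> nat \<Rightarrow> nat" where
  "conf K 0 = id"
| "conf K (Suc p) = (if p \<in> K then conf K p \<circ> transpose n (slot p) else conf K p)"

definition hand :: "nat set \<Rightarrow> nat \<Rightarrow> nat" where
  "hand K p = conf K p n"

definition met :: "nat set \<Rightarrow> nat \<Rightarrow> nat" where
  "met K p = conf K p (slot p)"

definition edges :: "nat set \<Rightarrow> nat set set" where
  "edges K = (\<lambda>p. {hand K p, met K p}) ` K"

definition hold_count :: "nat set \<Rightarrow> nat \<Rightarrow> nat \<Rightarrow> nat" where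
  "hold_count K p v = card {t. t < p \<and> hand K t = v}"

text \<open>These are the skip sets of the words to be counted: by \<open>pref_eq_id_iff\<close> the
  last two conditions together say that the product is \<open>e\<close>.\<close>

definition valid :: "nat set \<Rightarrow> bool" where
  "valid K \<longleftrightarrow> K \<subseteq> {..<n * (n - 1)} \<and> card K = 2 * n - 2 \<and> conf K (n * (n - 1)) = id \<and>
     (\<forall>v\<in>{1..n}. hold_count K (n * (n - 1)) v = n - 1)"

lemma slot_bounds: "1 \<le> slot p" "slot p < n" "slot p \<le> n" "slot p \<noteq> n"
proof -
  have "p mod (n - 1) < n - 1" using n2 by (intro mod_less_divisor) auto
  then show "1 \<le> slot p" "slot p < n" "slot p \<le> n" "slot p \<noteq> n" by (auto simp: slot_def)
qed

lemma slot_in: "slot p \<in> {1..n-1}" "slot p \<in> {1..n}"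
  using slot_bounds[of p] by auto

lemma bij_conf: "bij (conf K p)"
proof (induction p)
  case 0
  show ?case by (metis conf.simps(1) bij_id)
next
  case (Suc p)
  then show ?case by (auto intro: bij_comp)
qed

lemma conf_eq_iff [simp]: "conf K p i = conf K p j \<longleftrightarrow> i = j"
  using bij_conf[of K p] by (auto simp: bij_def inj_eq)

lemma conf_outside: "i \<notin> {1..n} \<Longrightarrow> conf K p i = i"
proof (induction p)
  case (Suc p)
  have "i \<noteq> n" "i \<noteq> slot p" using Suc.prems slot_in(2)[of p] n2 by auto
  then show ?case using Suc by (auto simp: transpose_def)
qed simp

lemma conf_in: "i \<in> {1..n} \<Longrightarrow> conf K p i \<in> {1..n}"
  using conf_outside[of "conf K p i" K p] conf_eq_iff by metis

lemma hand_in: "hand K p \<in> {1..n}"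
  unfolding hand_def using n2 by (intro conf_in) auto

lemma hand_neq_met: "hand K p \<noteq> met K p"
  using slot_bounds(4)[of p] by (auto simp: hand_def met_def)

lemma hand_Suc: "hand K (Suc p) = (if p \<in> K then met K p else hand K p)"
  by (auto simp: hand_def met_def)

lemma conf_Suc_slot: "conf K (Suc p) (slot p) = (if p \<in> K then hand K p else met K p)"
  by (auto simp: hand_def met_def)

lemma conf_Suc_other: "i \<noteq> n \<Longrightarrow> p \<notin> K \<or> i \<noteq> slot p \<Longrightarrow> conf K (Suc p) i = conf K p i"
  by (auto simp: transpose_def)

lemma hold_count_0 [simp]: "hold_count K 0 v = 0"
  by (simp add: hold_count_def)

lemma hold_count_Suc:
  "hold_count K (Suc p) v = hold_count K p v + (if hand K p = v then 1 else 0)"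
proof -
  have "{t. t < Suc p \<and> hand K t = v} =
    (if hand K p = v then insert p {t. t < p \<and> hand K t = v} else {t. t < p \<and> hand K t = v})"
    by (auto simp: less_Suc_eq)
  then show ?thesis by (auto simp: hold_count_def)
qed

section \<open>Prefix products and the exact position of each label\<close>

definition letter :: "nat set \<Rightarrow> nat \<Rightarrow> int \<Rightarrow> int" where
  "letter K p = (if p \<in> K then id else simple_refl n (p mod n))"

text \<open>A prefix product is read as an arrangement: \<open>pref K p q\<close> is the label at
  position \<open>q\<close>, and composing on the right with a reflection exchanges labels at
  neighbouring positions.\<close>

primrec pref :: "nat set \<Rightarrow> nat \<Rightarrow> int \<Rightarrow> int" where
  "pref K 0 = id"
| "pref K (Suc p) = pref K p \<circ> letter K p"

lemma simple_refl_eq: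
  "simple_refl n (p mod n) x =
    (if x mod int n = int p mod int n then x + 1
     else if x mod int n = (int p + 1) mod int n then x - 1 else x)"
  by (auto simp: simple_refl_def aff_transp_def zmod_int mod_add_left_eq)

lemma simple_refl_neq_id: "simple_refl n (p mod n) \<noteq> id"
proof
  assume "simple_refl n (p mod n) = id"
  then have "simple_refl n (p mod n) (int p) = int p" by simp
  then show False by (simp add: simple_refl_eq)
qed

lemma letter_shift: "letter K p (x + int n * k) = letter K p x + int n * k"
  by (auto simp: letter_def simple_refl_eq)

lemma pref_shift: "pref K p (x + int n * k) = pref K p x + int n * k"
  by (induction p arbitrary: x) (auto simp: letter_shift)

text \<open>At time \<open>p\<close>, the label with index \<open>i\<close> sits at a position congruent to \<open>p + 1 + off p i\<close>.\<close>
definition off :: "nat \<Rightarrow> nat \<Rightarrow> int" where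
  "off p i = (if i = n then - 1 else (int i - 1 - int p) mod (int n - 1))"

lemma off_hand [simp]: "off p n = - 1"
  by (simp add: off_def)

lemma off_bounds:
  assumes "i \<noteq> n" shows "0 \<le> off p i" "off p i \<le> int n - 2"
proof -
  have "0 < int n - 1" using n2 by simp
  from pos_mod_bound[OF this, of "int i - 1 - int p"] pos_mod_sign[OF this, of "int i - 1 - int p"]
  show "0 \<le> off p i" "off p i \<le> int n - 2" using assms by (auto simp: off_def)
qed

lemma off_eq_0_iff:
  assumes "i \<in> {1..n-1}" shows "off p i = 0 \<longleftrightarrow> i = slot p"
proof -
  have "off p i = 0 \<longleftrightarrow> (int i - 1) mod (int n - 1) = int p mod (int n - 1)"
    using assms by (auto simp: off_def mod_eq_0_iff_dvd mod_eq_dvd_iff)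
  also have "(int i - 1) mod (int n - 1) = int i - 1"
    using assms by (intro mod_pos_pos_trivial) auto
  also have "int p mod (int n - 1) = int (p mod (n - 1))"
    using n2 by (simp add: zmod_int of_nat_diff)
  finally show ?thesis using assms by (auto simp: slot_def)
qed

lemma off_slot [simp]: "off p (slot p) = 0"
  using off_eq_0_iff[of "slot p" p] slot_in(1)[of p] by simp

lemma off_Suc:
  assumes "i \<in> {1..n-1}"
  shows "off (Suc p) i = (if i = slot p then int n - 2 else off p i - 1)"
proof -
  have i: "i \<noteq> n" using assms n2 by auto
  have m: "0 < int n - 1" using n2 by simp
  have e: "off (Suc p) i = (off p i - 1) mod (int n - 1)"
    using i by (simp add: off_def mod_diff_left_eq algebra_simps)
  show ?thesis
  proof (cases "i = slot p")
    case True
    have "(- 1) mod (int n - 1) = int n - 2"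
      using m zmod_minus1 by auto
    then show ?thesis using e True by simp
  next
    case False
    then have "off p i \<noteq> 0" using off_eq_0_iff assms by simp
    then have "0 \<le> off p i - 1" "off p i - 1 < int n - 1" using off_bounds[OF i, of p] by auto
    then show ?thesis using e False by simp
  qed
qed

lemma off_Suc_slot [simp]: "off (Suc p) (slot p) = int n - 2"
  using off_Suc[OF slot_in(1)[of p], of p] by simp

text \<open>Modulo \<open>n\<close> the factor \<open>n - 1\<close> is \<open>- 1\<close>, so the
  invariant also gives the residue class of the position.\<close>

lemma position_mod:
  assumes "(int n - 1) * q = int n * X - int p - d - 1"
  shows "q mod int n = (int p + d + 1) mod int n"
proof -
  have "q = (int p + d + 1) + int n * (q - X)" using assms by (simp add: algebra_simps)
  then show ?thesis by (metis mod_mult_self2)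
qed

lemma mod_shift_eq:
  assumes "- int n < d" "d < int n" "(a + d) mod int n = a mod int n" shows "d = 0"
proof -
  have "int n dvd d" using assms(3) by (simp add: mod_eq_dvd_iff)
  then show ?thesis using assms(1,2) zdvd_imp_le[of "int n" d] zdvd_imp_le[of "int n" "- d"]
    by (cases "d > 0"; cases "d < 0") auto
qed

text \<open>A label in hand gains \<open>1\<close> per crossing and one in a slot loses \<open>1\<close> per crossing; both are
  encoded in one linear invariant for the exact position \<open>q\<close>, in which only the number of steps
  spent in hand depends on the skips.\<close>
lemma position:
  assumes "i \<in> {1..n}"
  shows "\<exists>q. pref K p q = int (conf K p i mod n) \<and>
    (int n - 1) * q = int n * (int (hold_count K p (conf K p i)) + int (conf K p i mod n))
      - int p - off p i - 1"
  using assms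
proof (induction p arbitrary: i)
  case 0
  have "(int n - 1) * int (i mod n) = int n * int (i mod n) - off 0 i - 1"
  proof (cases "i = n")
    case False
    then have "off 0 i = int i - 1" using 0 unfolding off_def
      by (auto intro!: mod_pos_pos_trivial)
    then show ?thesis using False 0 by (simp add: algebra_simps)
  qed simp
  then show ?case by (auto simp: algebra_simps)
next
  case (Suc p)
  have nin: "n \<in> {1..n}" using n2 by simp
  show ?case
  proof (cases "p \<in> K")
    case True
    have P: "pref K (Suc p) = pref K p" using True by (simp add: letter_def)
    consider "i = n" | "i = slot p" | "i \<noteq> n" "i \<noteq> slot p" by blast
    then show ?thesis
    proof cases
      case 1
      obtain q where "pref K p q = int (met K p mod n)"
        "(int n - 1) * q = int n * (int (hold_count K p (met K p)) + int (met K p mod n)) - int p - 1"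
        using Suc.IH[OF slot_in(2)[of p]] unfolding met_def[symmetric] by auto
      moreover have "conf K (Suc p) i = met K p" using 1 hand_Suc[of K p] True
        by (simp add: hand_def del: conf.simps)
      ultimately show ?thesis using 1 hand_neq_met[of K p] unfolding P
        by (intro exI[of _ q]) (simp add: hold_count_Suc del: conf.simps pref.simps)
    next
      case 2
      \<comment> \<open>Putting a label down adds 1 to its hold count and raises \<open>off\<close>
        from \<open>- 1\<close> to \<open>n - 2\<close>; the gain \<open>n\<close> is used up by
        this rise and the step itself, so the same \<open>q\<close> works.\<close>
      obtain q where "pref K p q = int (hand K p mod n)"
        "(int n - 1) * q = int n * (int (hold_count K p (hand K p)) + int (hand K p mod n)) - int p"
        using Suc.IH[OF nin] unfolding hand_def[symmetric] by auto
      moreover have "conf K (Suc p) i = hand K p" using 2 conf_Suc_slot[of K p] True by simp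
      ultimately show ?thesis using 2 unfolding P
        by (intro exI[of _ q]) (simp add: hold_count_Suc algebra_simps del: conf.simps pref.simps)
    next
      case 3
      obtain q where "pref K p q = int (conf K p i mod n)"
        "(int n - 1) * q = int n * (int (hold_count K p (conf K p i)) + int (conf K p i mod n))
          - int p - off p i - 1"
        using Suc.IH[OF Suc.prems] by auto
      moreover have "conf K (Suc p) i = conf K p i" using 3 by (intro conf_Suc_other) auto
      moreover have "hand K p \<noteq> conf K p i" using 3 by (simp add: hand_def)
      moreover have "off (Suc p) i = off p i - 1" using 3 Suc.prems off_Suc[of i p] by auto
      ultimately show ?thesis unfolding P
        by (intro exI[of _ q]) (simp add: hold_count_Suc del: conf.simps pref.simps)
    qed
  next
    case False
    have L: "letter K p = simple_refl n (p mod n)" using False by (simp add: letter_def)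
    have C: "conf K (Suc p) i = conf K p i" using False by simp
    obtain q where q: "pref K p q = int (conf K p i mod n)"
      "(int n - 1) * q = int n * (int (hold_count K p (conf K p i)) + int (conf K p i mod n))
          - int p - off p i - 1"
      using Suc.IH[OF Suc.prems] by auto
    note qm = position_mod[OF q(2)]
    have one: "(int p + 1) mod int n \<noteq> int p mod int n"
      using mod_shift_eq[of 1 "int p"] n2 by auto
    consider "i = n" | "i = slot p" | "i \<noteq> n" "i \<noteq> slot p" by blast
    then show ?thesis
    proof cases
      case 1
      have "q mod int n = int p mod int n" using qm 1 by simp
      then have "(q + 1) mod int n = (int p + 1) mod int n" by (metis mod_add_left_eq)
      then have "letter K p (q + 1) = q" using one by (simp add: L simple_refl_eq)
      moreover have "hand K p = conf K p i" using 1 by (simp add: hand_def)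
      moreover have "conf K (Suc p) n = conf K p n" using C 1 by blast
      ultimately show ?thesis using q 1
        by (intro exI[of _ "q + 1"]) (simp add: hold_count_Suc algebra_simps del: conf.simps)
    next
      case 2
      have "q mod int n = (int p + 1) mod int n" using qm 2 by simp
      then have "(q - 1) mod int n = int p mod int n" by (metis mod_diff_left_eq add_diff_cancel_right')
      then have "letter K p (q - 1) = q" by (simp add: L simple_refl_eq)
      moreover have "hand K p \<noteq> conf K p i" using 2 slot_bounds(4)[of p] by (simp add: hand_def)
      moreover have "conf K (Suc p) (slot p) = conf K p (slot p)" using C 2 by blast
      ultimately show ?thesis using q 2
        by (intro exI[of _ "q - 1"]) (simp add: hold_count_Suc algebra_simps del: conf.simps)
    next
      case 3
      have i: "i \<in> {1..n-1}" using 3 Suc.prems by auto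
      have o: "off (Suc p) i = off p i - 1" using 3 off_Suc[OF i] by auto
      have b: "0 < off p i" "off p i \<le> int n - 2"
        using off_bounds[OF 3(1), of p] off_eq_0_iff[OF i, of p] 3 by auto
      have "q mod int n \<noteq> int p mod int n"
        using qm mod_shift_eq[of "off p i + 1" "int p"] b by (auto simp: add.assoc)
      moreover have "q mod int n \<noteq> (int p + 1) mod int n"
        using qm mod_shift_eq[of "off p i" "int p + 1"] b by (auto simp: algebra_simps)
      ultimately have "letter K p q = q" by (simp add: L simple_refl_eq)
      moreover have "hand K p \<noteq> conf K p i" using 3 by (simp add: hand_def)
      ultimately show ?thesis using q o
        by (intro exI[of _ q]) (simp add: C hold_count_Suc algebra_simps del: conf.simps)
    qed
  qed
qed

lemma off_final:
  assumes "i \<in> {1..n}"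
  shows "off (n * (n - 1)) i + 1 = int (i mod n)"
proof (cases "i = n")
  case False
  then have i: "1 \<le> i" "i < n" using assms by auto
  have "int (n * (n - 1)) = int n * (int n - 1)" using n2 by (simp add: of_nat_diff)
  then have "int i - 1 - int (n * (n - 1)) = (int i - 1) + (int n - 1) * (- int n)"
    by (simp add: algebra_simps)
  then have "off (n * (n - 1)) i = (int i - 1) mod (int n - 1)"
    using False unfolding off_def by (simp only: mod_mult_self2 if_False)
  also have "\<dots> = int i - 1" using i by (intro mod_pos_pos_trivial) auto
  finally show ?thesis using i by simp
qed simp

text \<open>With \<open>v\<close> the final label at index \<open>i\<close> and \<open>h\<close> its
  hold count, \<open>q = v mod n\<close> turns the invariant into
  \<open>v mod n = i mod n + n * (n - 1 - h)\<close>. Reducing modulo \<open>n\<close> gives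
  \<open>v = i\<close>, and then \<open>h = n - 1\<close>. Conversely these values force
  \<open>q = i mod n\<close>, and periodicity covers all integers.\<close>

lemma pref_eq_id_iff:
  "pref K (n * (n - 1)) = id \<longleftrightarrow>
    conf K (n * (n - 1)) = id \<and> (\<forall>v\<in>{1..n}. hold_count K (n * (n - 1)) v = n - 1)"
    (is "pref K ?N = id \<longleftrightarrow> ?R")
proof
  have N: "int ?N = int n * (int n - 1)" using n2 by (simp add: of_nat_diff)
  {
    assume id: "pref K ?N = id"
    have *: "conf K ?N i = i \<and> hold_count K ?N i = n - 1" if i: "i \<in> {1..n}" for i
    proof -
      define v where "v = conf K ?N i"
      define h where "h = int (hold_count K ?N v)"
      have v: "v \<in> {1..n}" using conf_in[OF i] by (simp add: v_def)
      have "(int n - 1) * int (v mod n) = int n * (h + int (v mod n)) - int n * (int n - 1) - int (i mod n)"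
        using position[OF i, of K ?N] off_final[OF i] unfolding id N v_def h_def by auto
      then have e: "int (v mod n) = int (i mod n) + int n * (int n - 1 - h)" by (simp add: algebra_simps)
      then have "int (v mod n) mod int n = int (i mod n) mod int n" by (metis mod_mult_self2)
      then have vi: "v mod n = i mod n" by (simp flip: zmod_int)
      then have "v = i" using v i n2
        by (metis atLeastAtMost_iff le_neq_implies_less mod_less mod_self not_one_le_zero)
      moreover have "int n - 1 = h" using e vi n2 by simp
      then have "hold_count K ?N v = n - 1" unfolding h_def using n2 by linarith
      ultimately show ?thesis by (simp add: v_def)
    qed
    have "conf K ?N = id"
    proof
      fix i show "conf K ?N i = id i" using * conf_outside[of i K ?N] by (cases "i \<in> {1..n}") auto
    qed
    then show ?R using * by auto
  next
    assume R: ?R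
    have *: "pref K ?N (int j) = int j" if "j < n" for j
    proof -
      define i where "i = (if j = 0 then n else j)"
      have i: "i \<in> {1..n}" and ij: "i mod n = j" using that n2 by (auto simp: i_def)
      obtain q where q: "pref K ?N q = int j"
        "(int n - 1) * q = int n * (int (n - 1) + int j) - int n * (int n - 1) - int j"
        using position[OF i, of K ?N] off_final[OF i] R i ij N by auto
      have "(int n - 1) * q = (int n - 1) * int j" using q(2) n2 by (simp add: algebra_simps of_nat_diff)
      then have "q = int j" using n2 by simp
      then show ?thesis using q by simp
    qed
    show "pref K ?N = id"
    proof
      fix x :: int
      have "x = int (nat (x mod int n)) + int n * (x div int n)" using n2 by simp
      moreover have "nat (x mod int n) < n" using n2 by (simp add: nat_less_iff)
      ultimately show "pref K ?N x = id x" using pref_shift * by (metis id_apply)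
    qed
  }
qed

end

section \<open>The tree of a maximal distinguished subword\<close>

text \<open>A vertex of highest rank on a cycle can only be joined there to its own parent, but it
  has two distinct neighbours on the cycle.\<close>

lemma ranked_edges_acyclic:
  fixes rank :: "nat \<Rightarrow> nat"
  assumes E: "E \<subseteq> (\<lambda>s. {s, par s}) ` S" and rank: "\<And>s. s \<in> S \<Longrightarrow> rank (par s) < rank s"
  shows "\<not> has_cycle E"
proof
  assume "has_cycle E"
  then obtain vs where vs: "3 \<le> length vs" "distinct vs"
    "\<And>i. i < length vs \<Longrightarrow> {vs ! i, vs ! ((i + 1) mod length vs)} \<in> E"
    unfolding has_cycle_def by auto
  define L where "L = length vs"
  have nbr: "w = par v" if vw: "{v, w} \<in> E" and le: "rank w \<le> rank v" for v w
  proof -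
    obtain s where "s \<in> S" "{v, w} = {s, par s}" using E vw by blast
    then show ?thesis using rank[of s] le by (auto simp: doubleton_eq_iff)
  qed
  have "finite (rank ` set vs)" "rank ` set vs \<noteq> {}" using vs(1) by auto
  then have "Max (rank ` set vs) \<in> rank ` set vs" by (rule Max_in)
  then obtain j where j: "j < L" "rank (vs ! j) = Max (rank ` set vs)"
    by (auto simp: in_set_conv_nth L_def)
  have top: "rank (vs ! k) \<le> rank (vs ! j)" if "k < L" for k
    using that j(2) unfolding L_def by simp
  \<comment> \<open>The cyclic predecessor and successor of \<open>j\<close>; they differ because
    the length is at least 3.\<close>
  define a where "a = (if j = 0 then L - 1 else j - 1)"
  define b where "b = (if j = L - 1 then 0 else j + 1)"
  have ab: "a < L" "b < L" "a \<noteq> b" "(a + 1) mod L = j" "(j + 1) mod L = b"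
    using j(1) vs(1) unfolding L_def[symmetric] by (auto simp: a_def b_def)
  have "{vs ! j, vs ! b} \<in> E" "{vs ! j, vs ! a} \<in> E"
    using vs(3)[of j] vs(3)[of a] ab j(1) unfolding L_def[symmetric] by (auto simp: insert_commute)
  then have "vs ! b = vs ! a" using nbr top ab by metis
  then show False using vs(2) ab unfolding L_def by (simp add: nth_eq_iff_index_eq)
qed

context sweep
begin

section \<open>The skips at a single slot\<close>

definition slot_skips :: "nat set \<Rightarrow> nat \<Rightarrow> nat set" where
  "slot_skips K s = {p \<in> K. slot p = s}"

lemma conf_const:
  assumes "s \<noteq> n" "a \<le> b" "\<And>p. a \<le> p \<Longrightarrow> p < b \<Longrightarrow> p \<notin> slot_skips K s"
  shows "conf K b s = conf K a s"
  using assms(2,3)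
proof (induction b rule: dec_induct)
  case (step b)
  then show ?case using conf_Suc_other[of s b K] assms(1) by (auto simp: slot_skips_def simp del: conf.simps)
qed simp

lemma valid_finite: "valid K \<Longrightarrow> finite K"
  unfolding valid_def by (metis finite_lessThan finite_subset)

lemma hold_time:
  assumes "valid K" "v \<in> {1..n}"
  shows "\<exists>p < n * (n - 1). hand K p = v"
proof -
  have "hold_count K (n * (n - 1)) v \<noteq> 0" using assms n2 by (auto simp: valid_def)
  then have "{p. p < n * (n - 1) \<and> hand K p = v} \<noteq> {}" by (auto simp: hold_count_def simp del: Collect_empty_eq)
  then show ?thesis by blast
qed

text \<open>Without a skip at \<open>s\<close> the label \<open>s\<close> would never be held. A
  single skip would leave a foreign label in the slot to the end, although the final configuration
  is the identity.\<close>

lemma two_le_card_slot_skips: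
  assumes K: "valid K" and s: "s \<in> {1..n-1}"
  shows "2 \<le> card (slot_skips K s)"
proof (rule ccontr)
  let ?N = "n * (n - 1)"
  have sn: "s \<noteq> n" using s n2 by auto
  have sub: "slot_skips K s \<subseteq> {..<?N}" using K by (auto simp: valid_def slot_skips_def)
  have fin: "finite (slot_skips K s)" using sub finite_subset by blast
  assume "\<not> 2 \<le> card (slot_skips K s)"
  then consider "card (slot_skips K s) = 0" | "card (slot_skips K s) = 1" by linarith
  then show False
  proof cases
    case 1
    then have "slot_skips K s = {}" using fin by simp
    have "s \<in> {1..n}" using s by auto
    then obtain p where "hand K p = s" using hold_time[OF K] by blast
    moreover have "conf K p s = conf K 0 s"
      by (rule conf_const) (use sn \<open>slot_skips K s = {}\<close> in auto)
    ultimately show False using sn conf_eq_iff[of K p s n] by (simp add: hand_def)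
  next
    case 2
    then obtain a where a: "slot_skips K s = {a}" by (auto simp: card_1_singleton_iff)
    then have aK: "a \<in> K" "slot a = s" "a < ?N" using sub by (auto simp: slot_skips_def)
    have "conf K a s = conf K 0 s" by (rule conf_const) (use sn a in auto)
    then have "hand K a \<noteq> s" using sn conf_eq_iff[of K a s n] by (simp add: hand_def)
    moreover have "conf K ?N s = conf K (Suc a) s" by (rule conf_const) (use sn a aK in auto)
    ultimately show False using K conf_Suc_slot[of K a] aK by (simp add: valid_def del: conf.simps)
  qed
qed

text \<open>There are \<open>2 * n - 2\<close> skips and \<open>n - 1\<close> slots with at least
  two each, which leaves no surplus.\<close>

lemma card_slot_skips:
  assumes K: "valid K" and s: "s \<in> {1..n-1}"
  shows "card (slot_skips K s) = 2"
proof -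
  have fin: "finite K" using valid_finite[OF K] .
  have "K = (\<Union>s\<in>{1..n-1}. slot_skips K s)" using slot_in(1) by (auto simp: slot_skips_def)
  moreover have "card (\<Union>s\<in>{1..n-1}. slot_skips K s) = (\<Sum>s\<in>{1..n-1}. card (slot_skips K s))"
    using fin by (intro card_UN_disjoint) (auto simp: slot_skips_def)
  ultimately have "(\<Sum>s\<in>{1..n-1}. card (slot_skips K s)) = 2 * n - 2" using K by (simp add: valid_def)
  also have "\<dots> = (\<Sum>s\<in>{1..n-1}. 2)" using n2 by simp
  finally have e: "(\<Sum>s\<in>{1..n-1}. 2) = (\<Sum>s\<in>{1..n-1}. card (slot_skips K s))" by simp
  show ?thesis using sum_mono_inv[OF e _ s] two_le_card_slot_skips[OF K] by auto
qed

text \<open>The earlier skip \<open>A\<close> exchanges \<open>s\<close> for some \<open>y\<close>,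
  which stays until the later skip \<open>B\<close>. After \<open>B\<close> the content is final,
  hence \<open>s\<close>, so the hand at \<open>B\<close> must have been \<open>s\<close>.\<close>

lemma slot_history:
  assumes K: "valid K" and s: "s \<in> {1..n-1}"
  obtains A B y where "A < B" "B < n * (n - 1)" "slot_skips K s = {A, B}"
    "hand K A = y" "met K A = s" "hand K B = s" "met K B = y" "y \<noteq> s"
    "\<And>t. t \<le> A \<Longrightarrow> conf K t s = s"
    "\<And>t. t \<le> n * (n - 1) \<Longrightarrow> conf K t s = s \<or> conf K t s = y"
proof -
  let ?N = "n * (n - 1)"
  have sn: "s \<noteq> n" using s n2 by auto
  obtain a b where ab: "slot_skips K s = {a, b}" "a \<noteq> b"
    using card_slot_skips[OF K s] by (auto simp: card_2_iff)
  define A B where "A = min a b" and "B = max a b"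
  have AB: "slot_skips K s = {A, B}" "A < B" using ab by (auto simp: A_def B_def min_def max_def)
  then have "A \<in> K" "B \<in> K" "slot A = s" "slot B = s" by (auto simp: slot_skips_def)
  have "B < ?N" using \<open>B \<in> K\<close> K by (auto simp: valid_def)
  define y where "y = hand K A"
  have before: "conf K t s = s" if "t \<le> A" for t
    using conf_const[OF sn, of 0 t K] AB that by auto
  have mid: "conf K t s = y" if "A < t" "t \<le> B" for t
  proof -
    have "conf K t s = conf K (Suc A) s"
      using that AB by (intro conf_const[OF sn]) auto
    then show ?thesis using conf_Suc_slot[of K A] \<open>A \<in> K\<close> \<open>slot A = s\<close> by (simp add: y_def del: conf.simps)
  qed
  have after: "conf K t s = s" if "B < t" "t \<le> ?N" for t
  proof -
    have "conf K ?N s = conf K t s"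
      using that AB by (intro conf_const[OF sn]) auto
    then show ?thesis using K by (simp add: valid_def)
  qed
  have mA: "met K A = s" and mB: "met K B = y"
    using before[of A] mid[of B] \<open>A < B\<close> \<open>slot A = s\<close> \<open>slot B = s\<close> by (auto simp: met_def)
  have hB: "hand K B = s"
    using conf_Suc_slot[of K B] \<open>B \<in> K\<close> \<open>slot B = s\<close> after[of "Suc B"] \<open>B < ?N\<close>
    by (simp del: conf.simps)
  have "y \<noteq> s" using hand_neq_met[of K A] mA by (simp add: y_def)
  moreover have "conf K t s = s \<or> conf K t s = y" if "t \<le> ?N" for t
    using before[of t] mid[of t] after[of t] that by linarith
  ultimately show thesis using that[OF \<open>A < B\<close> \<open>B < ?N\<close> AB(1) y_def[symmetric] mA hB mB _ before]
    by blast
qed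

section \<open>Passages of a label along the slots\<close>

definition visits :: "nat set \<Rightarrow> nat \<Rightarrow> nat \<Rightarrow> nat set" where
  "visits K v s = {p. p < n * (n - 1) \<and> slot p = s \<and> hand K p = v}"

lemma finite_visits [simp]: "finite (visits K v s)"
  by (rule finite_subset[of _ "{..<n * (n - 1)}"]) (auto simp: visits_def)

lemma slot_Suc: "slot p < n - 1 \<Longrightarrow> slot (Suc p) = Suc (slot p)"
  by (auto simp: slot_def mod_Suc)

lemma slot_Suc_wrap: "slot p = n - 1 \<Longrightarrow> slot (Suc p) = 1"
  using n2 by (auto simp: slot_def mod_Suc)

lemma slot_final: "slot (n * (n - 1)) = 1"
  by (simp add: slot_def)

text \<open>The two skips at slot \<open>s\<close> exchange the same two labels in opposite directions, so the hands
  leaving \<open>s\<close> are, with multiplicity, the hands arriving there.\<close>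
lemma card_visits_Suc:
  assumes K: "valid K" and s: "1 \<le> s" "Suc s \<le> n - 1"
  shows "card (visits K v (Suc s)) = card (visits K v s)"
proof -
  let ?N = "n * (n - 1)"
  have s': "s \<in> {1..n-1}" using s by auto
  obtain A B y where h: "A < B" "B < ?N" "slot_skips K s = {A, B}"
    "hand K A = y" "met K A = s" "hand K B = s" "met K B = y" "y \<noteq> s"
    using slot_history[OF K s'] by metis
  have AB: "A \<in> K" "B \<in> K" "slot A = s" "slot B = s" and
    skip: "\<And>p. slot p = s \<Longrightarrow> p \<in> K \<longleftrightarrow> p = A \<or> p = B"
    using h(3) by (auto simp: slot_skips_def)
  define M where "M = {p. p < ?N \<and> slot p = s \<and> hand K (Suc p) = v}"
  \<comment> \<open>Times 0 and \<open>n * (n - 1)\<close> both face slot 1, which differs from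
    \<open>Suc s\<close>, so shifting by one step stays in range.\<close>
  have "visits K v (Suc s) = Suc ` M"
  proof (intro set_eqI iffI)
    fix q assume q: "q \<in> visits K v (Suc s)"
    then have "q \<noteq> 0" using s by (intro notI) (auto simp: visits_def slot_def)
    then obtain p where p: "q = Suc p" using not0_implies_Suc by blast
    have "slot p \<noteq> n - 1" using slot_Suc_wrap[of p] q p s by (auto simp: visits_def)
    then have "slot p < n - 1" using slot_bounds(2)[of p] by linarith
    then show "q \<in> Suc ` M" using q p slot_Suc[of p] by (auto simp: visits_def M_def)
  next
    fix q assume "q \<in> Suc ` M"
    then obtain p where p: "q = Suc p" "p < ?N" "slot p = s" "hand K (Suc p) = v" by (auto simp: M_def)
    have "slot q = Suc s" using p s slot_Suc[of p] by auto
    moreover have "q \<noteq> ?N" using slot_final \<open>slot q = Suc s\<close> s by auto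
    ultimately show "q \<in> visits K v (Suc s)" using p by (auto simp: visits_def)
  qed
  then have "card (visits K v (Suc s)) = card M" by (simp add: card_image)
  also have "card M = card (visits K v s)"
  proof (rule bij_betw_same_card)
    \<comment> \<open>At \<open>A\<close> the hand turns from \<open>y\<close> into
      \<open>s\<close>, at \<open>B\<close> from \<open>s\<close> into \<open>y\<close>; at other
      passages of this slot it stays. Swapping \<open>A\<close> and \<open>B\<close> thus matches
      hands after the step with hands before it.\<close>
    show "bij_betw (transpose A B) M (visits K v s)"
    proof (rule bij_betw_byWitness[where f' = "transpose A B"])
      show "transpose A B ` M \<subseteq> visits K v s" "transpose A B ` visits K v s \<subseteq> M"
        using h AB skip hand_Suc[of K]
        by (auto simp: M_def visits_def transpose_def split: if_splits)
    qed auto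
  qed
  finally show ?thesis .
qed

text \<open>The number of passages is the same for all \<open>n - 1\<close> slots, and the passages
  add up to the hold count \<open>n - 1\<close>.\<close>

lemma card_visits:
  assumes K: "valid K" and v: "v \<in> {1..n}" and s: "s \<in> {1..n-1}"
  shows "card (visits K v s) = 1"
proof -
  let ?N = "n * (n - 1)"
  have const: "card (visits K v t) = card (visits K v 1)" if "1 \<le> t" "t \<le> n - 1" for t
    using that
  proof (induction t rule: dec_induct)
    case (step t)
    then show ?case using card_visits_Suc[OF K, of t v] by simp
  qed simp
  have "{p. p < ?N \<and> hand K p = v} = (\<Union>t\<in>{1..n-1}. visits K v t)"
    using slot_in(1) by (auto simp: visits_def)
  moreover have "card (\<Union>t\<in>{1..n-1}. visits K v t) = (\<Sum>t\<in>{1..n-1}. card (visits K v t))"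
    by (intro card_UN_disjoint) (auto simp: visits_def)
  moreover have "(\<Sum>t\<in>{1..n-1}. card (visits K v t)) = (\<Sum>t\<in>{1..n-1}. card (visits K v 1))"
    by (rule sum.cong[OF refl const]) auto
  ultimately have "hold_count K ?N v = (n - 1) * card (visits K v 1)"
    by (simp add: hold_count_def)
  moreover have "hold_count K ?N v = n - 1" using K v unfolding valid_def by blast
  ultimately have "(n - 1) * card (visits K v 1) = (n - 1) * 1" by simp
  moreover have "n - 1 \<noteq> 0" using n2 by simp
  ultimately have "card (visits K v 1) = 1" by (simp only: mult_left_cancel simp_thms)
  then show ?thesis using const[of s] s by auto
qed

lemma visits_unique:
  assumes "valid K" "hand K p = hand K q" "slot p = slot q" "p < n * (n - 1)" "q < n * (n - 1)"
  shows "p = q"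
proof -
  have "card (visits K (hand K p) (slot p)) = 1"
    using assms(1) hand_in slot_in by (intro card_visits) auto
  moreover have "p \<in> visits K (hand K p) (slot p)" "q \<in> visits K (hand K p) (slot p)"
    using assms by (auto simp: visits_def)
  ultimately show ?thesis by (metis card_1_singletonE singletonD)
qed

text \<open>An edge is a pair \<open>{s, y}\<close> exchanged at slot \<open>s\<close>, and that
  slot never holds anything else. If one of the two is in hand and the other is met, slot
  \<open>s\<close> holds the latter and is the slot being faced; as each label faces it only once,
  the time is one of its two skips.\<close>

lemma valid_skip_iff:
  assumes K: "valid K" and p: "p < n * (n - 1)"
  shows "p \<in> K \<longleftrightarrow> {hand K p, met K p} \<in> edges K"
proof
  assume "{hand K p, met K p} \<in> edges K"
  then obtain q where q: "q \<in> K" "{hand K p, met K p} = {hand K q, met K q}" by (auto simp: edges_def)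
  define s where "s = slot q"
  have s: "s \<in> {1..n-1}" unfolding s_def by (rule slot_in)
  obtain A B y where h: "A < B" "B < n * (n - 1)" "slot_skips K s = {A, B}"
    "hand K A = y" "met K A = s" "hand K B = s" "met K B = y" "y \<noteq> s"
    "\<And>t. t \<le> n * (n - 1) \<Longrightarrow> conf K t s = s \<or> conf K t s = y"
    using slot_history[OF K s] by metis
  have AB: "A \<in> K" "B \<in> K" "slot A = s" "slot B = s" using h(3) by (auto simp: slot_skips_def)
  have "q \<in> slot_skips K s" using q by (simp add: slot_skips_def s_def)
  then have "q = A \<or> q = B" using h(3) by auto
  then have "{hand K p, met K p} = {s, y}" using q(2) h by auto
  then consider "hand K p = s" "met K p = y" | "hand K p = y" "met K p = s"
    by (auto simp: doubleton_eq_iff)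
  then show "p \<in> K"
  proof cases
    case 1
    have "conf K p s \<noteq> s" using 1(1) conf_eq_iff[of K p s n] s by (auto simp: hand_def)
    then have "conf K p s = conf K p (slot p)" using h(9)[of p] p 1(2) by (simp add: met_def)
    then have "slot p = s" by simp
    then have "p = B" using visits_unique[OF K, of p B] 1 h AB p by auto
    then show ?thesis using AB by simp
  next
    case 2
    have "conf K p s \<noteq> y" using 2(1) conf_eq_iff[of K p s n] s by (auto simp: hand_def)
    then have "conf K p s = conf K p (slot p)" using h(9)[of p] p 2(2) by (simp add: met_def)
    then have "slot p = s" by simp
    then have "p = A" using visits_unique[OF K, of p A] 2 h AB p by auto
    then show ?thesis using AB by simp
  qed
qed (simp add: edges_def)

text \<open>The edges and the current configuration decide whether a step is a skip, so by induction
  both sets pass through the same configurations.\<close>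

lemma edges_inj:
  assumes K: "valid K" "valid K'" and e: "edges K = edges K'"
  shows "K = K'"
proof -
  let ?N = "n * (n - 1)"
  have step: "p \<in> K \<longleftrightarrow> p \<in> K'" if "conf K p = conf K' p" "p < ?N" for p
    using valid_skip_iff[OF K(1) that(2)] valid_skip_iff[OF K(2) that(2)] e that(1)
    by (simp add: hand_def met_def)
  have c: "conf K p = conf K' p" if "p \<le> ?N" for p
    using that by (induction p) (use step in auto)
  show ?thesis using step c K by (auto simp: valid_def)
qed

lemma edges_tree:
  assumes K: "valid K"
  shows "edges K \<in> labeled_trees n"
proof -
  let ?N = "n * (n - 1)"
  have met_in: "met K p \<in> {1..n}" for p
    unfolding met_def using slot_in by (intro conf_in) auto
  have "edges K \<subseteq> graph_edges_on n"
    using hand_in met_in hand_neq_met unfolding edges_def graph_edges_on_def by blast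
  moreover have "graph_connected n (edges K)"
  proof -
    have sy: "sym ((adj_rel (edges K))\<^sup>*)"
      by (intro sym_rtrancl) (auto simp: sym_def adj_rel_def insert_commute)
    have hand_conn: "(n, hand K p) \<in> (adj_rel (edges K))\<^sup>*" for p
    proof (induction p)
      case (Suc p)
      have "(hand K p, met K p) \<in> adj_rel (edges K)" if "p \<in> K"
        using that hand_neq_met by (auto simp: adj_rel_def edges_def)
      then show ?case using Suc by (auto simp: hand_Suc intro: rtrancl_into_rtrancl)
    qed (simp add: hand_def)
    have "(n, v) \<in> (adj_rel (edges K))\<^sup>*" if v: "v \<in> {1..n}" for v
      using hold_time[OF K v] hand_conn by auto
    then show ?thesis unfolding graph_connected_def using sy by (meson symD rtrancl_trans)
  qed
  moreover have "\<not> has_cycle (edges K)"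
  proof -
    \<comment> \<open>The time of first being in hand serves as rank. The parent of \<open>s\<close>
      is the label \<open>y\<close> in hand at the first skip at slot \<open>s\<close>: until then
      \<open>s\<close> sits in its slot, so it is held only later.\<close>
    define first where "first v = (LEAST p. hand K p = v)" for v
    have "\<exists>y. slot_skips K s \<noteq> {} \<and> first y < first s \<and> (\<forall>p\<in>slot_skips K s. {hand K p, met K p} = {s, y})"
      if s: "s \<in> {1..n-1}" for s
    proof -
      obtain A B y where h: "A < B" "B < ?N" "slot_skips K s = {A, B}"
        "hand K A = y" "met K A = s" "hand K B = s" "met K B = y" "y \<noteq> s"
        "\<And>t. t \<le> A \<Longrightarrow> conf K t s = s"
        using slot_history[OF K s] by metis
      have "first y \<le> A" unfolding first_def using h(4) by (rule Least_le)
      moreover have "hand K (first s) = s" unfolding first_def using h(6) by (rule LeastI)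
      then have "conf K (first s) s \<noteq> s" using conf_eq_iff[of K "first s" s n] s by (auto simp: hand_def)
      then have "A < first s" using h(9)[of "first s"] by linarith
      ultimately show ?thesis using h by (intro exI[of _ y]) auto
    qed
    then obtain par where par: "\<And>s. s \<in> {1..n-1} \<Longrightarrow> first (par s) < first s \<and>
       (\<forall>p\<in>slot_skips K s. {hand K p, met K p} = {s, par s})" by metis
    have "edges K \<subseteq> (\<lambda>s. {s, par s}) ` {1..n-1}"
    proof
      fix e assume "e \<in> edges K"
      then obtain p where p: "p \<in> K" "e = {hand K p, met K p}" by (auto simp: edges_def)
      then have "e = {slot p, par (slot p)}"
        using par[OF slot_in(1)[of p]] by (auto simp: slot_skips_def)
      then show "e \<in> (\<lambda>s. {s, par s}) ` {1..n-1}" using slot_in(1) by blast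
    qed
    then show ?thesis using par by (intro ranked_edges_acyclic[where rank = first and S = "{1..n-1}"]) auto
  qed
  ultimately show ?thesis by (simp add: labeled_trees_def)
qed

end

section \<open>The traversal of a rooted tree\<close>

text \<open>The tree is rooted at \<open>n\<close>, so its edges \<open>{s, par s}\<close> are
  indexed by the slots; the decreasing rank makes every climb end at the root.\<close>

locale sweep_tree = sweep +
  fixes par :: "nat \<Rightarrow> nat" and rank :: "nat \<Rightarrow> nat"
  assumes par_in: "s \<in> {1..n-1} \<Longrightarrow> par s \<in> {1..n}"
    and rank_par: "s \<in> {1..n-1} \<Longrightarrow> rank (par s) < rank s"
begin

definition nx :: "nat \<Rightarrow> nat" where
  "nx s = s mod (n - 1) + 1"

text \<open>The state is the hand label and the slot faced, without the slot contents: the hand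
  changes at \<open>s\<close> only along \<open>{s, par s}\<close>. Agreement with
  \<open>conf\<close> is shown in \<open>dfs_conf\<close>.\<close>

definition move :: "nat \<times> nat \<Rightarrow> nat \<times> nat" where
  "move z = (case z of (x, s) \<Rightarrow> (if x = s then par s else if x = par s then s else x, nx s))"

definition walk :: "nat \<Rightarrow> nat" where
  "walk p = fst ((move ^^ p) (n, 1))"

lemma par_neq: "s \<in> {1..n-1} \<Longrightarrow> par s \<noteq> s"
  using rank_par by fastforce

lemma nx_slot: "nx (slot p) = slot (Suc p)"
  by (simp add: nx_def slot_def mod_Suc_eq)

lemma nx_in: "nx s \<in> {1..n-1}"
  using slot_in(1)[of s] by (simp add: nx_def slot_def)

lemma nx_Suc: "s < n - 1 \<Longrightarrow> nx s = Suc s"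
  by (simp add: nx_def)

lemma move_pow: "(move ^^ p) (n, 1) = (walk p, slot p)"
proof -
  have "snd ((move ^^ p) (n, 1)) = slot p"
  proof (induction p)
    case (Suc p)
    then show ?case by (auto simp: move_def split: prod.splits simp flip: nx_slot)
  qed (simp add: slot_def)
  then show ?thesis by (simp add: walk_def prod_eq_iff)
qed

lemma walk_Suc:
  "walk (Suc p) = (if walk p = slot p then par (slot p)
     else if walk p = par (slot p) then slot p else walk p)"
proof -
  have "walk (Suc p) = fst (move ((move ^^ p) (n, 1)))" by (simp add: walk_def)
  then show ?thesis unfolding move_pow by (simp add: move_def)
qed

lemma walk_in: "walk p \<in> {1..n}"
proof (induction p)
  case 0
  then show ?case using n2 by (simp add: walk_def)
next
  case (Suc p)
  then show ?case using par_in[OF slot_in(1)[of p]] slot_in(2)[of p] by (auto simp: walk_Suc)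
qed

text \<open>Starting behind its own slot, a hand \<open>v\<close> that is restored after every
  foreign slot goes round the circle until it reaches slot \<open>v\<close>. The starting state is
  inserted because \<open>orbit\<close> begins with the first image.\<close>

lemma round_orbit:
  assumes v: "v \<in> {1..n-1}" and i: "i < n - 1"
    and step: "\<And>s. s \<in> {1..n-1} \<Longrightarrow> s \<noteq> v \<Longrightarrow> (v, nx s) \<in> orbit move (v, s)"
  shows "(v, (v + i) mod (n - 1) + 1) \<in> insert (v, nx v) (orbit move (v, nx v))"
  using i
proof (induction i)
  case (Suc i)
  define s where "s = (v + i) mod (n - 1) + 1"
  have s: "s \<in> {1..n-1}" using nx_in[of "v + i"] by (simp add: s_def nx_def)
  have e: "nx s = (v + Suc i) mod (n - 1) + 1" by (simp add: s_def nx_def mod_Suc_eq)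
  have "s \<noteq> v"
  proof
    assume "s = v"
    then have "(v + i) mod (n - 1) = (v - 1) mod (n - 1)" using v by (auto simp: s_def)
    then have "(n - 1) dvd (v + i) - (v - 1)" by (simp add: mod_eq_dvd_iff_nat)
    then have "n - 1 dvd Suc i" using v by simp
    then show False using Suc.prems by (auto dest: dvd_imp_le)
  qed
  then have "(v, nx s) \<in> orbit move (v, s)" using step s by blast
  moreover have "(v, s) \<in> insert (v, nx v) (orbit move (v, nx v))" using Suc by (simp add: s_def)
  ultimately show ?case unfolding e[symmetric] using orbit_trans by fast
qed (simp add: nx_def)

text \<open>The detour below a child \<open>t\<close> of \<open>v\<close> ends at the slot where it started.\<close>
lemma step_orbit:
  assumes "v \<in> {1..n}" "t \<in> {1..n-1}" "t \<noteq> v"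
  shows "(v, nx t) \<in> orbit move (v, t)"
proof -
  \<comment> \<open>The difference to the largest rank is smaller for a child than for its parent,
    so the induction treats children first.\<close>
  define D where "D = Max (rank ` {1..n})"
  have D: "rank v \<le> D" if "v \<in> {1..n}" for v using that by (simp add: D_def)
  show ?thesis
    using assms
  proof (induction v arbitrary: t rule: measure_induct_rule[where f = "\<lambda>v. D - rank v"])
    case (less v)
    show ?case
    proof (cases "par t = v")
      case True
      have tn: "t \<in> {1..n}" using less.prems(2) by auto
      have m: "D - rank t < D - rank v" using rank_par[OF less.prems(2)] D[OF tn] True by simp
      \<comment> \<open>A round takes \<open>t\<close> from the slot after its own to its own slot;
        there the next move returns the hand to \<open>v\<close>.\<close>
      have "(t, (t + (n - 2)) mod (n - 1) + 1) \<in> insert (t, nx t) (orbit move (t, nx t))"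
        using n2 by (intro round_orbit less.prems less.IH[OF m tn]) auto
      moreover have "(t + (n - 2)) mod (n - 1) + 1 = t"
      proof -
        have "t + (n - 2) = (t - 1) + (n - 1)" using less.prems(2) n2 by auto
        then have "(t + (n - 2)) mod (n - 1) = (t - 1) mod (n - 1)" by simp
        also have "\<dots> = t - 1" using less.prems(2) by (intro mod_less) auto
        finally show ?thesis using less.prems(2) by simp
      qed
      moreover have "move (v, t) = (t, nx t)" using True less.prems by (simp add: move_def)
      then have "(t, nx t) \<in> orbit move (v, t)" using orbit.base[of move "(v, t)"] by simp
      ultimately have "(t, t) \<in> orbit move (v, t)" using orbit_trans by fastforce
      then have "move (t, t) \<in> orbit move (v, t)" by (rule orbit.step)
      moreover have "move (t, t) = (v, nx t)" using True by (simp add: move_def)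
      ultimately show ?thesis by metis
    next
      case False
      then have "move (v, t) = (v, nx t)" using less.prems by (simp add: move_def)
      then show ?thesis using orbit.base[of move "(v, t)"] by simp
    qed
  qed
qed

text \<open>No slot has the number \<open>n\<close>, so \<open>step_orbit\<close> applies to the
  root at every slot and carries it round the whole circle.\<close>

lemma root_orbit:
  assumes "s \<in> {1..n-1}"
  shows "(n, s) \<in> orbit move (n, 1)"
proof -
  have nn: "n \<in> {1..n}" using n2 by simp
  have *: "(n, nx t) \<in> orbit move (n, 1)" if "1 \<le> t" "t \<le> n - 1" for t
    using that
  proof (induction t rule: dec_induct)
    case base
    then show ?case using step_orbit[OF nn, of 1] n2 by auto
  next
    case (step t)
    have "(n, nx (Suc t)) \<in> orbit move (n, Suc t)"
      using step step_orbit[OF nn, of "Suc t"] n2 by auto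
    moreover have "(n, Suc t) \<in> orbit move (n, 1)" using step nx_Suc[of t] by auto
    ultimately show ?case by (rule orbit_trans)
  qed
  show ?thesis
  proof (cases "s = 1")
    case True
    have "nx (n - 1) = 1" by (simp add: nx_def)
    then show ?thesis using *[of "n - 1"] n2 True by auto
  next
    case False
    then have "nx (s - 1) = s" using assms by (auto simp: nx_Suc)
    then show ?thesis using *[of "s - 1"] False assms by auto
  qed
qed

text \<open>By induction the parent of \<open>v\<close> comes to slot \<open>v\<close>; there
  \<open>v\<close> is picked up, and its round leads past every slot.\<close>

lemma all_orbit:
  assumes "v \<in> {1..n}" "s \<in> {1..n-1}"
  shows "(v, s) \<in> orbit move (n, 1)"
  using assms
proof (induction v arbitrary: s rule: measure_induct_rule[where f = rank])
  case (less v)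
  show ?case
  proof (cases "v = n")
    case True
    then show ?thesis using root_orbit less.prems by simp
  next
    case False
    then have v: "v \<in> {1..n-1}" using less.prems by auto
    have "(par v, v) \<in> orbit move (n, 1)" using less.IH[OF rank_par[OF v] par_in[OF v] v] .
    then have "move (par v, v) \<in> orbit move (n, 1)" by (rule orbit.step)
    then have start: "(v, nx v) \<in> orbit move (n, 1)" using par_neq[OF v] by (simp add: move_def)
    \<comment> \<open>\<open>i\<close> is the number of slots to advance from \<open>nx v\<close> to
      \<open>s\<close>; for \<open>s\<close> at most \<open>v\<close> a full circle
      \<open>n - 1\<close> is added.\<close>
    obtain i where i: "i < n - 1" "(v + i) mod (n - 1) + 1 = s"
    proof (cases "v < s")
      case True
      then show thesis using that[of "s - 1 - v"] v less.prems by auto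
    next
      case False
      then have "v + (n - 1 + s - 1 - v) = (s - 1) + (n - 1)" using v less.prems by auto
      then have "(v + (n - 1 + s - 1 - v)) mod (n - 1) = (s - 1) mod (n - 1)" by simp
      also have "\<dots> = s - 1" using less.prems by (intro mod_less) auto
      finally show thesis using that[of "n - 1 + s - 1 - v"] False v less.prems by auto
    qed
    have "(v, s) \<in> insert (v, nx v) (orbit move (v, nx v))"
      using round_orbit[OF v i(1)] step_orbit[OF less.prems(1)] i(2) by auto
    then show ?thesis using start orbit_trans by fast
  qed
qed

text \<open>The initial state lies on its own orbit, so the walk is periodic, and the orbit consists
  of all \<open>n * (n - 1)\<close> states. This number is therefore the period, and each state
  occurs once in it.\<close>

lemma walk_slot_bij:
  "bij_betw (\<lambda>p. (walk p, slot p)) {..<n * (n - 1)} ({1..n} \<times> {1..n-1})"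
  and walk_final: "walk (n * (n - 1)) = n"
proof -
  let ?z = "(n, 1::nat)"
  have zz: "?z \<in> orbit move ?z" using n2 by (intro root_orbit) auto
  define d where "d = funpow_dist1 move ?z ?z"
  have img: "orbit move ?z = (\<lambda>p. (move ^^ p) ?z) ` {0..<d}"
    unfolding d_def using zz by (rule orbit_conv_funpow_dist1)
  have inj: "inj_on (\<lambda>p. (move ^^ p) ?z) {0..<d}"
    unfolding d_def using zz by (rule inj_on_funpow_dist1)
  have "orbit move ?z = {1..n} \<times> {1..n-1}"
    using all_orbit walk_in slot_in(1) unfolding img move_pow by auto
  then have X: "(\<lambda>p. (walk p, slot p)) ` {0..<d} = {1..n} \<times> {1..n-1}"
    using img unfolding move_pow by simp
  have "d = card ({1..n} \<times> {1..n-1})"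
    using card_image[OF inj] X unfolding move_pow by simp
  then have d: "d = n * (n - 1)" by (simp add: card_cartesian_product)
  show "bij_betw (\<lambda>p. (walk p, slot p)) {..<n * (n - 1)} ({1..n} \<times> {1..n-1})"
    using X inj unfolding bij_betw_def move_pow d by (simp add: atLeast0LessThan)
  have "(move ^^ d) ?z = ?z" unfolding d_def using zz by (rule funpow_dist1_prop)
  then show "walk (n * (n - 1)) = n" by (simp add: walk_def d)
qed

lemma card_steps:
  "card {p. p < n * (n - 1) \<and> P (walk p) (slot p)} = card {(x, s). x \<in> {1..n} \<and> s \<in> {1..n-1} \<and> P x s}"
proof (rule bij_betw_same_card)
  let ?g = "\<lambda>p. (walk p, slot p)"
  let ?A = "{p. p < n * (n - 1) \<and> P (walk p) (slot p)}"
  let ?B = "{(x, s). x \<in> {1..n} \<and> s \<in> {1..n-1} \<and> P x s}"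
  note inj = bij_betw_imp_inj_on[OF walk_slot_bij] and img = bij_betw_imp_surj_on[OF walk_slot_bij]
  have "?g ` ?A = ?B"
  proof (intro equalityI subsetI)
    fix z assume "z \<in> ?B"
    then obtain x s where z: "z = (x, s)" "(x, s) \<in> {1..n} \<times> {1..n-1}" "P x s" by blast
    from z(2) obtain p where "p \<in> {..<n * (n - 1)}" "(x, s) = ?g p"
      unfolding img[symmetric] by (rule imageE)
    then show "z \<in> ?g ` ?A" using z by (intro image_eqI[of _ _ p]) auto
  next
    fix z assume "z \<in> ?g ` ?A"
    then obtain p where "z = ?g p" "P (walk p) (slot p)" by blast
    then show "z \<in> ?B" using walk_in slot_in(1) by simp
  qed
  moreover have "inj_on ?g ?A" by (rule inj_on_subset[OF inj]) auto
  ultimately show "bij_betw ?g ?A ?B" by (simp only: bij_betw_def simp_thms)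
qed

section \<open>The skip set of the traversal\<close>

definition dfs_skips :: "nat set" where
  "dfs_skips = {p. p < n * (n - 1) \<and> (walk p = slot p \<or> walk p = par (slot p))}"

definition parent_rel :: "(nat \<times> nat) set" where
  "parent_rel = {(s, par s) | s. s \<in> {1..n-1}}"

lemma ancestor_iff:
  assumes "s \<in> {1..n-1}"
  shows "(s, t) \<in> parent_rel\<^sup>* \<longleftrightarrow> t = s \<or> (par s, t) \<in> parent_rel\<^sup>*"
proof
  assume "(s, t) \<in> parent_rel\<^sup>*"
  then show "t = s \<or> (par s, t) \<in> parent_rel\<^sup>*"
    by (cases rule: converse_rtranclE) (auto simp: parent_rel_def)
next
  have "(s, par s) \<in> parent_rel" using assms by (auto simp: parent_rel_def)
  then show "t = s \<or> (par s, t) \<in> parent_rel\<^sup>* \<Longrightarrow> (s, t) \<in> parent_rel\<^sup>*"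
    by (auto intro: converse_rtrancl_into_rtrancl)
qed

lemma ancestor_rank: "(x, t) \<in> parent_rel\<^sup>* \<Longrightarrow> rank t \<le> rank x"
proof (induction rule: rtrancl_induct)
  case (step y z)
  then show ?case using rank_par[of y] by (auto simp: parent_rel_def)
qed simp

lemma not_ancestor_par: "s \<in> {1..n-1} \<Longrightarrow> (par s, s) \<notin> parent_rel\<^sup>*"
  using ancestor_rank rank_par by (meson leD)

lemma ancestor_root: "(n, t) \<in> parent_rel\<^sup>* \<longleftrightarrow> t = n"
proof
  assume "(n, t) \<in> parent_rel\<^sup>*"
  then show "t = n" using n2 by (cases rule: converse_rtranclE) (auto simp: parent_rel_def)
qed simp

text \<open>Picking up \<open>s\<close> leaves \<open>par s\<close> in slot \<open>s\<close>, where
  it stays until the traversal leaves the subtree of \<open>s\<close> through \<open>s\<close>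
  itself. So at every skip the slot offers just the label that the walk goes to.\<close>

lemma dfs_conf:
  assumes "p \<le> n * (n - 1)"
  shows "conf dfs_skips p n = walk p \<and>
    (\<forall>s\<in>{1..n-1}. conf dfs_skips p s = (if (walk p, s) \<in> parent_rel\<^sup>* then par s else s))"
  using assms
proof (induction p)
  case 0
  then show ?case using n2 by (auto simp: walk_def ancestor_root)
next
  case (Suc p)
  define t where "t = slot p"
  have t: "t \<in> {1..n-1}" "t \<noteq> n" using slot_in(1)[of p] slot_bounds(4)[of p] by (auto simp: t_def)
  have sn: "s \<noteq> n" if "s \<in> {1..n-1}" for s using that n2 by auto
  have IH: "conf dfs_skips p n = walk p"
    "\<And>s. s \<in> {1..n-1} \<Longrightarrow> conf dfs_skips p s = (if (walk p, s) \<in> parent_rel\<^sup>* then par s else s)"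
    using Suc by auto
  have skip: "p \<in> dfs_skips \<longleftrightarrow> walk p = t \<or> walk p = par t"
    using Suc.prems by (simp add: dfs_skips_def t_def)
  \<comment> \<open>The ancestor chains of \<open>t\<close> and \<open>par t\<close>, each including
    its vertex, differ by \<open>t\<close> alone, so a skip changes the content of slot
    \<open>t\<close> only.\<close>
  consider "walk p = t" | "walk p = par t" "walk p \<noteq> t" | "walk p \<noteq> t" "walk p \<noteq> par t" by blast
  then show ?case
  proof cases
    case 1
    then have "walk (Suc p) = par t" by (simp add: walk_Suc t_def)
    then show ?thesis
      using 1 skip IH ancestor_iff[OF t(1)] not_ancestor_par[OF t(1)] sn t
      by (auto simp: transpose_def t_def[symmetric])
  next
    case 2
    then have "walk (Suc p) = t" by (simp add: walk_Suc t_def)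
    then show ?thesis
      using 2 skip IH ancestor_iff[OF t(1)] not_ancestor_par[OF t(1)] sn t
      by (auto simp: transpose_def t_def[symmetric])
  next
    case 3
    then have "walk (Suc p) = walk p" by (simp add: walk_Suc t_def)
    then show ?thesis using 3 skip IH by simp
  qed
qed

text \<open>By \<open>card_steps\<close> it suffices to count pairs: a label faces
  \<open>n - 1\<close> slots, and slot \<open>s\<close> is skipped by the distinct hands
  \<open>s\<close> and \<open>par s\<close>. At the end the hand is the root, which is below no slot
  label, so every slot has its own label back.\<close>

lemma dfs_valid: "valid dfs_skips"
proof -
  let ?N = "n * (n - 1)"
  have hand: "hand dfs_skips p = walk p" if "p \<le> ?N" for p
    using dfs_conf[OF that] by (simp add: hand_def)
  have "hold_count dfs_skips ?N v = n - 1" if v: "v \<in> {1..n}" for v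
  proof -
    have "{t. t < ?N \<and> hand dfs_skips t = v} = {t. t < ?N \<and> walk t = v}"
      using hand by auto
    then have "hold_count dfs_skips ?N v = card {(x, s). x \<in> {1..n} \<and> s \<in> {1..n-1} \<and> x = v}"
      using card_steps[of "\<lambda>x s. x = v"] by (simp add: hold_count_def)
    also have "{(x, s). x \<in> {1..n} \<and> s \<in> {1..n-1} \<and> x = v} = {v} \<times> {1..n-1}" using v by auto
    finally show ?thesis by simp
  qed
  moreover have "card dfs_skips = 2 * n - 2"
  proof -
    have "card dfs_skips = card {(x, s). x \<in> {1..n} \<and> s \<in> {1..n-1} \<and> (x = s \<or> x = par s)}"
      unfolding dfs_skips_def by (rule card_steps)
    also have "{(x, s). x \<in> {1..n} \<and> s \<in> {1..n-1} \<and> (x = s \<or> x = par s)}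
       = (\<lambda>s. (s, s)) ` {1..n-1} \<union> (\<lambda>s. (par s, s)) ` {1..n-1}"
      using par_in by fastforce
    also have "card \<dots> = card ((\<lambda>s. (s, s)) ` {1..n-1}) + card ((\<lambda>s. (par s, s)) ` {1..n-1})"
      using par_neq by (intro card_Un_disjoint) auto
    also have "\<dots> = (n - 1) + (n - 1)" by (simp add: card_image inj_on_def)
    finally show ?thesis by simp
  qed
  moreover have "conf dfs_skips ?N = id"
  proof
    fix i
    consider "i = n" | "i \<in> {1..n-1}" | "i \<notin> {1..n}" by fastforce
    then show "conf dfs_skips ?N i = id i"
    proof cases
      case 2
      then have "i \<noteq> n" using n2 by auto
      then show ?thesis using 2 dfs_conf[of ?N] walk_final ancestor_root by auto
    qed (use dfs_conf[of ?N] walk_final conf_outside in auto)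
  qed
  ultimately show ?thesis by (auto simp: valid_def dfs_skips_def)
qed

lemma dfs_edges: "edges dfs_skips = (\<lambda>s. {s, par s}) ` {1..n-1}"
proof -
  have e: "{hand dfs_skips p, met dfs_skips p} = {slot p, par (slot p)}" if "p \<in> dfs_skips" for p
  proof -
    have "p \<le> n * (n - 1)" "walk p = slot p \<or> walk p = par (slot p)"
      using that by (auto simp: dfs_skips_def)
    then show ?thesis
      using dfs_conf[of p] slot_in(1)[of p] not_ancestor_par[of "slot p"]
      by (auto simp: hand_def met_def)
  qed
  show ?thesis
  proof (intro equalityI subsetI)
    fix x assume "x \<in> (\<lambda>s. {s, par s}) ` {1..n-1}"
    then obtain s where s: "s \<in> {1..n-1}" "x = {s, par s}" by auto
    \<comment> \<open>The step at which \<open>s\<close> faces its own slot is a skip and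
      contributes the edge of \<open>s\<close>.\<close>
    then have "(s, s) \<in> {1..n} \<times> {1..n-1}" by auto
    then obtain p where "p \<in> {..<n * (n - 1)}" "(s, s) = (walk p, slot p)"
      unfolding bij_betw_imp_surj_on[OF walk_slot_bij, symmetric] by (rule imageE)
    then have "p \<in> dfs_skips" "slot p = s" by (auto simp: dfs_skips_def)
    then show "x \<in> edges dfs_skips" using e[of p] s unfolding edges_def by auto
  next
    fix x assume "x \<in> edges dfs_skips"
    then obtain p where p: "p \<in> dfs_skips" "x = {hand dfs_skips p, met dfs_skips p}"
      unfolding edges_def by blast
    show "x \<in> (\<lambda>s. {s, par s}) ` {1..n-1}"
      using e[OF p(1)] p(2) slot_in(1)[of p] by (intro image_eqI[of _ _ "slot p"]) simp_all
  qed
qed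

end

section \<open>The bijection\<close>

lemma rtrancl_distinct_path:
  assumes "(a, b) \<in> r\<^sup>*"
  shows "\<exists>vs. vs \<noteq> [] \<and> distinct vs \<and> hd vs = a \<and> last vs = b \<and>
    (\<forall>i. Suc i < length vs \<longrightarrow> (vs ! i, vs ! Suc i) \<in> r)"
  using assms
proof (induction rule: rtrancl_induct)
  case base
  show ?case by (rule exI[of _ "[a]"]) simp
next
  case (step b c)
  then obtain vs where vs: "vs \<noteq> []" "distinct vs" "hd vs = a" "last vs = b"
    "\<And>i. Suc i < length vs \<Longrightarrow> (vs ! i, vs ! Suc i) \<in> r" by blast
  show ?case
  proof (cases "c \<in> set vs")
    case True
    then obtain k where k: "k < length vs" "vs ! k = c" by (auto simp: in_set_conv_nth)
    \<comment> \<open>A path that comes back to \<open>c\<close> is cut at the earlier occurrence of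
      \<open>c\<close>.\<close>
    have "last (take (Suc k) vs) = c" using k by (simp add: take_Suc_conv_app_nth)
    then show ?thesis using vs k
      by (intro exI[of _ "take (Suc k) vs"]) (auto simp: hd_take)
  next
    case False
    have "((vs @ [c]) ! i, (vs @ [c]) ! Suc i) \<in> r" if "Suc i < length (vs @ [c])" for i
    proof (cases "Suc i < length vs")
      case True
      then show ?thesis using vs(5) by (simp add: nth_append)
    next
      case False
      then have i: "Suc i = length vs" using that by simp
      then have "vs ! i = b" using vs(1,4) by (metis diff_Suc_1 last_conv_nth)
      moreover have "i < length vs" using i by simp
      ultimately show ?thesis using i step.hyps(2) by (simp add: nth_append)
    qed
    then show ?thesis using vs False by (intro exI[of _ "vs @ [c]"]) auto
  qed
qed

text \<open>If \<open>{a, b}\<close> were not in \<open>T\<close>, a path in \<open>T\<close> from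
  \<open>a\<close> to \<open>b\<close> would have at least three vertices and close up with this
  edge to a cycle of \<open>E\<close>.\<close>

lemma connected_subgraph_of_acyclic:
  assumes acyc: "\<not> has_cycle E" and sub: "T \<subseteq> E" and ab: "{a, b} \<in> E" "a \<noteq> b"
    and conn: "(a, b) \<in> (adj_rel T)\<^sup>*"
  shows "{a, b} \<in> T"
proof (rule ccontr)
  assume notin: "{a, b} \<notin> T"
  obtain vs where vs: "vs \<noteq> []" "distinct vs" "hd vs = a" "last vs = b"
    "\<And>i. Suc i < length vs \<Longrightarrow> (vs ! i, vs ! Suc i) \<in> adj_rel T"
    using rtrancl_distinct_path[OF conn] by blast
  define L where "L = length vs"
  have ends: "vs ! 0 = a" "vs ! (L - 1) = b" using vs by (auto simp: hd_conv_nth last_conv_nth L_def)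
  have "L \<noteq> 0" "L \<noteq> 1" using vs ab(2) ends by (auto simp: L_def)
  moreover have "L \<noteq> 2"
  proof
    assume L: "L = 2"
    then have "(vs ! 0, vs ! 1) \<in> adj_rel T" using vs(5)[of 0] by (simp add: L_def)
    then show False using ends notin L by (simp add: adj_rel_def)
  qed
  ultimately have L3: "3 \<le> L" by linarith
  have "{vs ! i, vs ! ((i + 1) mod L)} \<in> E" if "i < L" for i
  proof (cases "Suc i < L")
    case True
    then show ?thesis using vs(5)[of i] sub by (auto simp: adj_rel_def L_def)
  next
    case False
    then have "Suc i = L" using that by simp
    then have "i = L - 1" "(i + 1) mod L = 0" by auto
    then show ?thesis using ends ab(1) by (simp add: insert_commute)
  qed
  then have "has_cycle E" unfolding has_cycle_def using L3 vs(2) by (auto simp: L_def)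
  then show False using acyc by contradiction
qed

text \<open>The rank is the distance from \<open>n\<close>, and a parent is the last vertex before
  \<open>s\<close> on a shortest path. The parent edges already connect every vertex to
  \<open>n\<close>, so acyclicity leaves no room for further edges.\<close>

lemma labeled_tree_parent:
  assumes n: "2 \<le> n" and E: "E \<in> labeled_trees n"
  obtains par and rank :: "nat \<Rightarrow> nat"
  where "\<And>s. s \<in> {1..n-1} \<Longrightarrow> par s \<in> {1..n} \<and> rank (par s) < rank s"
    and "E = (\<lambda>s. {s, par s}) ` {1..n-1}"
proof -
  have sub: "E \<subseteq> graph_edges_on n" and conn: "graph_connected n E" and acyc: "\<not> has_cycle E"
    using E by (auto simp: labeled_trees_def)
  define rank where "rank v = (LEAST k. (n, v) \<in> adj_rel E ^^ k)" for v
  have "\<exists>u. u \<in> {1..n} \<and> rank u < rank s \<and> {s, u} \<in> E" if s: "s \<in> {1..n-1}" for s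
  proof -
    have "n \<in> {1..n}" "s \<in> {1..n}" using s n by auto
    then have "(n, s) \<in> (adj_rel E)\<^sup>*" using conn unfolding graph_connected_def by blast
    then obtain k where "(n, s) \<in> adj_rel E ^^ k" using rtrancl_imp_relpow by blast
    then have r: "(n, s) \<in> adj_rel E ^^ rank s" unfolding rank_def by (rule LeastI)
    then have "rank s \<noteq> 0" using s n by (intro notI) auto
    then obtain m where m: "rank s = Suc m" using not0_implies_Suc by blast
    obtain u where u: "(n, u) \<in> adj_rel E ^^ m" "(u, s) \<in> adj_rel E"
      using r unfolding m by (rule relpow_Suc_E)
    have "rank u \<le> m" unfolding rank_def using u(1) by (rule Least_le)
    moreover have "{s, u} \<in> E" using u(2) by (auto simp: adj_rel_def insert_commute)
    moreover have "u \<in> {1..n}"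
    proof -
      have "{s, u} \<in> graph_edges_on n" using \<open>{s, u} \<in> E\<close> sub by blast
      then show ?thesis unfolding graph_edges_on_def by (auto simp: doubleton_eq_iff)
    qed
    ultimately show ?thesis using m by (intro exI[of _ u]) simp
  qed
  then have "\<forall>s\<in>{1..n-1}. \<exists>u. u \<in> {1..n} \<and> rank u < rank s \<and> {s, u} \<in> E" by blast
  from bchoice[OF this]
  obtain par where par: "\<And>s. s \<in> {1..n-1} \<Longrightarrow> par s \<in> {1..n} \<and> rank (par s) < rank s \<and> {s, par s} \<in> E"
    by blast
  define T where "T = (\<lambda>s. {s, par s}) ` {1..n-1}"
  have TE: "T \<subseteq> E" unfolding T_def using par by blast
  have sy: "sym ((adj_rel T)\<^sup>*)"
    by (intro sym_rtrancl) (auto simp: sym_def adj_rel_def insert_commute)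
  have root: "(v, n) \<in> (adj_rel T)\<^sup>*" if "v \<in> {1..n}" for v
    using that
  proof (induction v rule: measure_induct_rule[where f = rank])
    case (less v)
    show ?case
    proof (cases "v = n")
      case False
      then have v: "v \<in> {1..n-1}" using less.prems by auto
      have "v \<noteq> par v" using par[OF v] by auto
      then have "(v, par v) \<in> adj_rel T" using v by (auto simp: adj_rel_def T_def)
      moreover have "(par v, n) \<in> (adj_rel T)\<^sup>*" using less.IH par[OF v] by blast
      ultimately show ?thesis by (rule converse_rtrancl_into_rtrancl)
    qed simp
  qed
  have "E \<subseteq> T"
  proof
    fix e assume e: "e \<in> E"
    then have "e \<in> graph_edges_on n" using sub by blast
    then obtain a b where ab: "e = {a, b}" "a \<in> {1..n}" "b \<in> {1..n}" "a \<noteq> b"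
      unfolding graph_edges_on_def by blast
    have "(a, b) \<in> (adj_rel T)\<^sup>*"
      using rtrancl_trans[OF root[OF ab(2)] symD[OF sy root[OF ab(3)]]] .
    then show "e \<in> T" using connected_subgraph_of_acyclic[OF acyc TE, of a b] e ab(1,4) by blast
  qed
  then have img: "E = (\<lambda>s. {s, par s}) ` {1..n-1}" using TE unfolding T_def by (rule equalityI)
  have "\<And>s. s \<in> {1..n-1} \<Longrightarrow> par s \<in> {1..n} \<and> rank (par s) < rank s"
    using par by blast
  from that[OF this img] show thesis .
qed

context sweep
begin

lemma ex_valid_edges:
  assumes "E \<in> labeled_trees n"
  shows "\<exists>K. valid K \<and> edges K = E"
proof (rule labeled_tree_parent[OF n2 assms])
  fix par and rank :: "nat \<Rightarrow> nat"
  assume par: "\<And>s. s \<in> {1..n-1} \<Longrightarrow> par s \<in> {1..n} \<and> rank (par s) < rank s"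
    and E: "E = (\<lambda>s. {s, par s}) ` {1..n-1}"
  interpret sweep_tree n par rank
    by unfold_locales (rule par[THEN conjunct1], assumption, rule par[THEN conjunct2], assumption)
  have "valid dfs_skips \<and> edges dfs_skips = E" unfolding E using dfs_valid dfs_edges by (rule conjI)
  then show ?thesis by (rule exI)
qed

lemma edges_bij: "bij_betw edges {K. valid K} (labeled_trees n)"
  unfolding bij_betw_def
proof
  show "inj_on edges {K. valid K}" by (intro inj_onI edges_inj) simp_all
  show "edges ` {K. valid K} = labeled_trees n" 
  proof (intro equalityI subsetI)
    fix E assume "E \<in> labeled_trees n"
    then obtain K where "valid K" "edges K = E" using ex_valid_edges by blast
    then show "E \<in> edges ` {K. valid K}" by (intro image_eqI[of _ _ K]) simp_all
  qed (use edges_tree in auto)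
qed

section \<open>Skip sets as encodings of subwords\<close>

definition skip_word :: "nat set \<Rightarrow> (int \<Rightarrow> int) list" where
  "skip_word K = map (letter K) [0..<n * (n - 1)]"

lemma letter_eq_id_iff: "letter K p = id \<longleftrightarrow> p \<in> K"
  using simple_refl_neq_id by (simp add: letter_def)

lemma skip_word_nth: "p < n * (n - 1) \<Longrightarrow> skip_word K ! p = letter K p"
  by (simp add: skip_word_def)

lemma word_prod_skip_word: "word_prod (skip_word K) = pref K (n * (n - 1))"
proof -
  \<comment> \<open>\<open>foldr\<close> unfolds a word from the front, while \<open>pref\<close>
    grows at the end.\<close>
  have snoc: "word_prod (u @ [x]) = word_prod u \<circ> x" for u x
    by (induction u) (auto simp: word_prod_def comp_assoc)
  have "word_prod (map (letter K) [0..<p]) = pref K p" for p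
    by (induction p) (simp_all add: snoc, simp add: word_prod_def)
  then show ?thesis by (simp add: skip_word_def)
qed

lemma skip_word_in_iff:
  assumes K: "K \<subseteq> {..<n * (n - 1)}"
  shows "skip_word K \<in> max_dist_subwords n \<longleftrightarrow> valid K"
proof -
  have len: "length (skip_word K) = n * (n - 1)" "length (lambda_word n) = n * (n - 1)"
    by (simp_all add: skip_word_def lambda_word_def)
  have "skip_word K \<in> subwords n"
    using len by (auto simp: subwords_def skip_word_nth letter_def lambda_word_def)
  \<comment> \<open>Skips are numbered from 1, the elements of \<open>K\<close> from 0.\<close>
  moreover have "skips n (skip_word K) = Suc ` K"
  proof (intro set_eqI iffI)
    fix j assume "j \<in> skips n (skip_word K)"
    then have j: "1 \<le> j" "j - 1 < n * (n - 1)" "skip_word K ! (j - 1) = id"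
      using len by (auto simp: skips_def)
    then have "j - 1 \<in> K" by (simp add: skip_word_nth letter_eq_id_iff)
    then show "j \<in> Suc ` K" using j(1) by (metis imageI Suc_pred' One_nat_def Suc_le_lessD)
  next
    fix j assume "j \<in> Suc ` K"
    then obtain p where "j = Suc p" "p \<in> K" by auto
    then show "j \<in> skips n (skip_word K)"
      using K len by (auto simp: skips_def skip_word_nth letter_eq_id_iff)
  qed
  ultimately show ?thesis
    using K unfolding max_dist_subwords_def valid_def word_prod_skip_word pref_eq_id_iff[symmetric]
    by (simp add: card_image word_prod_skip_word)
qed

lemma skip_word_surj:
  assumes "u \<in> max_dist_subwords n"
  shows "u = skip_word {p. p < n * (n - 1) \<and> u ! p = id}"
proof (rule nth_equalityI)
  have u: "length u = n * (n - 1)" "\<And>p. p < n * (n - 1) \<Longrightarrow> u ! p = simple_refl n (p mod n) \<or> u ! p = id"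
    using assms by (auto simp: max_dist_subwords_def subwords_def lambda_word_def)
  then show "length u = length (skip_word {p. p < n * (n - 1) \<and> u ! p = id})"
    by (simp add: skip_word_def)
  fix p assume "p < length u"
  then show "u ! p = skip_word {p. p < n * (n - 1) \<and> u ! p = id} ! p"
    using u by (auto simp: skip_word_nth letter_def)
qed

lemma skip_word_bij: "bij_betw skip_word {K. valid K} (max_dist_subwords n)"
  unfolding bij_betw_def
proof
  have bound: "valid K \<Longrightarrow> K \<subseteq> {..<n * (n - 1)}" for K by (simp add: valid_def)
  show "inj_on skip_word {K. valid K}"
  proof (rule inj_onI)
    fix K K' assume K: "K \<in> {K. valid K}" "K' \<in> {K. valid K}" and e: "skip_word K = skip_word K'"
    have "p \<in> K \<longleftrightarrow> p \<in> K'" if "p < n * (n - 1)" for p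
      using e that skip_word_nth letter_eq_id_iff by metis
    then show "K = K'" using K bound by blast
  qed
  show "skip_word ` {K. valid K} = max_dist_subwords n"
  proof (intro equalityI subsetI)
    fix u assume "u \<in> skip_word ` {K. valid K}"
    then show "u \<in> max_dist_subwords n" using skip_word_in_iff bound by blast
  next
    fix u assume u: "u \<in> max_dist_subwords n"
    define K where "K = {p. p < n * (n - 1) \<and> u ! p = id}"
    have "u = skip_word K" unfolding K_def using u by (rule skip_word_surj)
    moreover have "K \<subseteq> {..<n * (n - 1)}" by (auto simp: K_def)
    ultimately show "u \<in> skip_word ` {K. valid K}" using u skip_word_in_iff by blast
  qed
qed

end

theorem theorem6p1:
  fixes n :: nat
  assumes "n \<ge> 2"
  shows "\<exists>f. bij_betw f (max_dist_subwords n) (labeled_trees n)"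
proof -
  interpret sweep n by unfold_locales (rule assms)
  show ?thesis
    using bij_betw_trans[OF bij_betw_inv_into[OF skip_word_bij] edges_bij] by blast
qed

end
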